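(* Let $\mathcal{K}_{3,3}^3$ be the $3$-graph with vertices $x_1,x_2,x_3,y_1,y_2,y_3$, $z_{ij}$ ($1\le i,j\le3$) and edges $\{x_1,x_2,x_3\}$, $\{y_1,y_2,y_3\}$, $\{x_i,y_j,z_{ij}\}$ ($1\le i,j\le 3$). Then $\mathrm{ex}(n,\mathcal{K}_{3,3}^3)=\frac{2}{25}n^3+o(n^3)$.
   Context: $\mathrm{ex}(n,F)$ denotes the maximum number of edges in a $3$-graph on $n$ vertices containing no (not necessarily induced) copy of $F$. *)

theory Defs
  imports Complex_Main "HOL-Library.Landau_Symbols"
begin

type_synonym 'a hypergraph = "'a set \<times> 'a set set"

definition vertices :: "'a hypergraph \<Rightarrow> 'a set" where
  "vertices H = fst H"

definition edges :: "'a hypergraph \<Rightarrow> 'a set set" where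
  "edges H = snd H"

definition three_graph :: "'a hypergraph \<Rightarrow> bool" where
  "three_graph H \<longleftrightarrow>
     finite (vertices H) \<and> (\<forall>e\<in>edges H. e \<subseteq> vertices H \<and> card e = 3)"

(* G contains a not necessarily induced copy of F. *)
definition contains_copy :: "'a hypergraph \<Rightarrow> 'b hypergraph \<Rightarrow> bool" where
  "contains_copy G F \<longleftrightarrow>
     (\<exists>f. inj_on f (vertices F) \<and> f ` vertices F \<subseteq> vertices G \<and>
          (\<forall>e\<in>edges F. f ` e \<in> edges G))"

(* Every 3-graph on n vertices is isomorphic to one with vertex set {..<n}.  The set below is
   always finite, and it is nonempty as soon as F has an edge (see the lemmas that follow), so
   Max is then a genuine maximum. *)
definition ex_sizes :: "nat \<Rightarrow> 'b hypergraph \<Rightarrow> nat set" where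
  "ex_sizes n F =
     {card (edges G) | G :: nat hypergraph.
        three_graph G \<and> vertices G = {..<n} \<and> \<not> contains_copy G F}"

definition ex :: "nat \<Rightarrow> 'b hypergraph \<Rightarrow> nat" where
  "ex n F = Max (ex_sizes n F)"

datatype kvertex = X nat | Y nat | Z nat nat

definition K333 :: "kvertex hypergraph" where
  "K333 =
     (X ` {1..3} \<union> Y ` {1..3} \<union> {Z i j | i j. i \<in> {1..3} \<and> j \<in> {1..3}},
      {{X 1, X 2, X 3}, {Y 1, Y 2, Y 3}} \<union>
      {{X i, Y j, Z i j} | i j. i \<in> {1..3} \<and> j \<in> {1..3}})"

lemma finite_ex_sizes: "finite (ex_sizes n F)"
proof -
  have "ex_sizes n F \<subseteq> card ` Pow (Pow {..<n})"
    by (auto simp: ex_sizes_def three_graph_def)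
  then show ?thesis
    by (rule finite_subset) simp
qed

lemma ex_sizes_nonempty:
  assumes "edges F \<noteq> {}"
  shows "ex_sizes n F \<noteq> {}"
proof -
  have "card (edges ({..<n}, {})) \<in> ex_sizes n F"
    unfolding ex_sizes_def using assms
    by (intro CollectI exI[of _ "({..<n}, {})"])
       (auto simp: three_graph_def contains_copy_def vertices_def edges_def)
  then show ?thesis by blast
qed

lemma three_graph_K333: "three_graph K333"
proof -
  have "{Z i j | i j. i \<in> {1..3} \<and> j \<in> {1..3}} = (\<lambda>(i, j). Z i j) ` ({1..3} \<times> {1..3})"
    by auto
  then have "finite {Z i j | i j. i \<in> {1..3} \<and> j \<in> {1..3}}"
    by simp
  then show ?thesis
    by (auto simp: three_graph_def K333_def vertices_def edges_def)
qed

lemma edges_K333_nonempty: "edges K333 \<noteq> {}"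
  by (simp add: K333_def edges_def)

end

theory Submission
  imports Defs "HOL-Library.Ramsey"
begin

text \<open>Deleting the edges on pairs of codegree less than \<open>15\<close> costs \<open>O(n\<^sup>2)\<close> edges and leaves a 3-graph
  that admits not even a homomorphism from \<open>K333\<close>, that is, one without two disjoint edges all of
  whose cross pairs are covered by edges. It remains to bound the Lagrangian of such a 3-graph by
  \<open>2 / 25\<close>. If some pair of vertices is uncovered, the weight of one of the two can be moved to the
  other, and the vertex disappears. If all pairs are covered, the 3-graph is intersecting and can be
  shifted towards the heavier vertices. Once shifting and merging both stop, either there are at
  most five vertices, and the complete 3-graph has Lagrangian at most \<open>2 / 25\<close>, or the 3-graph is a
  star, whose Lagrangian is at most \<open>2 / 27\<close>. The balanced blow-up of the complete 3-graph on five
  vertices gives the lower bound.\<close>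

section \<open>Lagrangians\<close>

text \<open>The Lagrange polynomial of \<open>G\<close>, without a factorial factor: for a 3-graph
  and constant weights \<open>1 / n\<close> it equals \<open>card G / n ^ 3\<close>.\<close>

definition weight :: "('a \<Rightarrow> real) \<Rightarrow> 'a set set \<Rightarrow> real" where
  "weight x G = (\<Sum>e\<in>G. \<Prod>v\<in>e. x v)"

definition covered :: "'a set set \<Rightarrow> 'a \<Rightarrow> 'a \<Rightarrow> bool" where
  "covered G u v \<longleftrightarrow> (\<exists>e\<in>G. {u, v} \<subseteq> e)"

text \<open>No homomorphism from \<open>K333\<close> to \<open>G\<close>; the images of the vertices \<open>Z i j\<close> may coincide with
  each other and with further vertices of the two disjoint edges.\<close>

definition hom_free :: "'a set set \<Rightarrow> bool" where
  "hom_free G \<longleftrightarrow>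
     (\<forall>e\<in>G. \<forall>f\<in>G. e \<inter> f = {} \<longrightarrow> (\<exists>u\<in>e. \<exists>v\<in>f. \<not> covered G u v))"

definition intersecting :: "'a set set \<Rightarrow> bool" where
  "intersecting G \<longleftrightarrow> (\<forall>e\<in>G. \<forall>f\<in>G. e \<inter> f \<noteq> {})"

lemma covered_mono: "covered H u v \<Longrightarrow> H \<subseteq> G \<Longrightarrow> covered G u v"
  unfolding covered_def by blast

lemma hom_free_subset: "hom_free G \<Longrightarrow> H \<subseteq> G \<Longrightarrow> hom_free H"
  unfolding hom_free_def by (metis covered_mono subsetD)

lemma intersecting_imp_hom_free: "intersecting G \<Longrightarrow> hom_free G"
  unfolding intersecting_def hom_free_def by blast

section \<open>Elementary symmetric polynomials, complete 3-graphs and stars\<close>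

lemma weight_nsets_insert:
  assumes "finite V" "a \<notin> V"
  shows "weight x (nsets (insert a V) (Suc k)) = weight x (nsets V (Suc k)) + x a * weight x (nsets V k)"
proof -
  have *: "nsets (insert a V) (Suc k) = nsets V (Suc k) \<union> insert a ` nsets V k"
  proof (intro subset_antisym subsetI)
    fix e assume e: "e \<in> nsets (insert a V) (Suc k)"
    show "e \<in> nsets V (Suc k) \<union> insert a ` nsets V k"
    proof (cases "a \<in> e")
      case True
      then have "e = insert a (e - {a})" "e - {a} \<in> nsets V k"
        using e by (auto simp: nsets_def)
      then show ?thesis by blast
    qed (use e in \<open>auto simp: nsets_def\<close>)
  next
    fix e assume "e \<in> nsets V (Suc k) \<union> insert a ` nsets V k"
    then show "e \<in> nsets (insert a V) (Suc k)"
      using assms by (auto simp: nsets_def card_insert_if)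
  qed
  have inj: "inj_on (insert a) (nsets V k)"
    using assms by (auto simp: inj_on_def nsets_def)
  have "weight x (nsets (insert a V) (Suc k)) =
        weight x (nsets V (Suc k)) + (\<Sum>e\<in>insert a ` nsets V k. \<Prod>v\<in>e. x v)"
    unfolding weight_def *
    by (rule sum.union_disjoint) (use assms in \<open>auto simp: finite_imp_finite_nsets nsets_def\<close>)
  also have "(\<Sum>e\<in>insert a ` nsets V k. \<Prod>v\<in>e. x v) = (\<Sum>e\<in>nsets V k. x a * (\<Prod>v\<in>e. x v))"
    unfolding sum.reindex[OF inj] o_def
    by (intro sum.cong refl) (subst prod.insert; use assms in \<open>auto simp: nsets_def\<close>)
  finally show ?thesis by (simp add: weight_def sum_distrib_left)
qed

lemma weight_nsets_1: "finite V \<Longrightarrow> weight x (nsets V (Suc 0)) = sum x V"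
  by (simp add: nsets_one weight_def sum.reindex)

lemma weight_nsets_2:
  "finite V \<Longrightarrow> 2 * weight x (nsets V 2) = (sum x V)\<^sup>2 - (\<Sum>v\<in>V. (x v)\<^sup>2)"
proof (induction V rule: finite_induct)
  case empty
  then show ?case by (simp add: nsets_eq_empty weight_def)
next
  case (insert a V)
  then show ?case
    using weight_nsets_insert[of V a x 1]
    by (simp add: weight_nsets_1 numeral_2_eq_2[symmetric] power2_sum algebra_simps)
qed

text \<open>Newton's identity. For total weight 1 it turns the weight of the complete 3-graph into a
  sum of functions of one variable, which can be estimated vertex by vertex.\<close>

lemma weight_nsets_3:
  "finite V \<Longrightarrow> 6 * weight x (nsets V 3) =
     (sum x V) ^ 3 - 3 * sum x V * (\<Sum>v\<in>V. (x v)\<^sup>2) + 2 * (\<Sum>v\<in>V. x v ^ 3)"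
proof (induction V rule: finite_induct)
  case empty
  then show ?case by (simp add: nsets_eq_empty weight_def)
next
  case (insert a V)
  have "6 * weight x (nsets (insert a V) 3) =
        6 * weight x (nsets V 3) + 3 * x a * (2 * weight x (nsets V 2))"
    using weight_nsets_insert[OF insert(1,2), of x 2] by (simp add: eval_nat_numeral)
  then show ?case
    unfolding insert.IH weight_nsets_2[OF insert(1)]
    using insert(1,2) by (simp add: algebra_simps power2_eq_square power3_eq_cube)
qed

lemma weight_mono:
  assumes "finite V" "G \<subseteq> H" "H \<subseteq> nsets V k" "\<And>v. v \<in> V \<Longrightarrow> 0 \<le> x v"
  shows "weight x G \<le> weight x H"
  unfolding weight_def
proof (rule sum_mono2)
  show "finite H"
    using assms finite_imp_finite_nsets finite_subset by metis
  show "0 \<le> prod x e" if "e \<in> H - G" for e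
  proof (intro prod_nonneg assms)
    show "v \<in> V" if "v \<in> e" for v
      using that \<open>e \<in> H - G\<close> assms(3) by (auto simp: nsets_def)
  qed
qed (use assms in auto)

lemma weight_le_of_card_le_5:
  assumes "finite V" "card V \<le> 5" "G \<subseteq> nsets V 3" "\<And>v. v \<in> V \<Longrightarrow> 0 \<le> x v" "sum x V = 1"
  shows "weight x G \<le> 2 / 25"
proof -
  \<comment> \<open>The right-hand side is the tangent of the left-hand side at \<open>1 / 5\<close>.\<close>
  have *: "3 * (x v)\<^sup>2 - 2 * x v ^ 3 \<ge> 24 / 25 * x v - 11 / 125" if "v \<in> V" for v
  proof -
    have "x v \<le> 1"
      using member_le_sum[OF that, of x] assms by auto
    then have "0 \<le> (x v - 1 / 5)\<^sup>2 * (11 / 5 - 2 * x v)"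
      by (intro mult_nonneg_nonneg) auto
    also have "\<dots> = 3 * (x v)\<^sup>2 - 2 * x v ^ 3 - (24 / 25 * x v - 11 / 125)"
      by (simp add: field_simps power2_eq_square power3_eq_cube)
    finally show ?thesis by simp
  qed
  \<comment> \<open>Equality for five vertices; fewer vertices only increase the sum of the
    tangents.\<close>
  have "13 / 25 \<le> 24 / 25 - 11 / 125 * real (card V)"
    using assms(2) by simp
  also have "\<dots> = (\<Sum>v\<in>V. 24 / 25 * x v - 11 / 125)"
    by (simp only: sum_subtractf assms(5) flip: sum_distrib_left) simp
  also have "\<dots> \<le> (\<Sum>v\<in>V. 3 * (x v)\<^sup>2 - 2 * x v ^ 3)"
    by (intro sum_mono *)
  also have "\<dots> = 3 * (\<Sum>v\<in>V. (x v)\<^sup>2) - 2 * (\<Sum>v\<in>V. x v ^ 3)"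
    by (simp add: sum_subtractf sum_distrib_left)
  also have "\<dots> = 1 - 6 * weight x (nsets V 3)"
    using weight_nsets_3[OF assms(1), of x] assms(5) by simp
  finally have "weight x (nsets V 3) \<le> 2 / 25" by simp
  with weight_mono[of V G "nsets V 3" 3 x] assms show ?thesis by simp
qed

text \<open>The link of \<open>a\<close> is a graph of total vertex weight \<open>1 - x a\<close>,
  so its weight is at most \<open>(1 - x a)^2 / 2\<close>. This leaves a cubic in
  \<open>x a\<close>.\<close>

lemma weight_star_le:
  assumes "finite V" "a \<in> V" "G \<subseteq> nsets V 3" "\<And>e. e \<in> G \<Longrightarrow> a \<in> e"
    "\<And>v. v \<in> V \<Longrightarrow> 0 \<le> x v" "sum x V = 1"
  shows "weight x G \<le> 2 / 25"
proof -
  let ?W = "V - {a}"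
  have sum_W: "sum x ?W = 1 - x a"
    using assms by (simp add: sum_diff1)
  have inj: "inj_on (insert a) (nsets ?W 2)"
    by (auto simp: inj_on_def nsets_def)
  have sub: "G \<subseteq> insert a ` nsets ?W 2"
  proof
    fix e assume "e \<in> G"
    with assms have "e = insert a (e - {a})" "e - {a} \<in> nsets ?W 2"
      by (auto simp: nsets_def)
    then show "e \<in> insert a ` nsets ?W 2" by blast
  qed
  have "insert a ` nsets ?W 2 \<subseteq> nsets V 3"
    using assms by (auto simp: nsets_def card_insert_if)
  then have "weight x G \<le> weight x (insert a ` nsets ?W 2)"
    using assms sub by (intro weight_mono) auto
  also have "\<dots> = (\<Sum>e\<in>nsets ?W 2. x a * (\<Prod>v\<in>e. x v))"
    unfolding weight_def sum.reindex[OF inj] o_def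
    by (intro sum.cong refl) (subst prod.insert; auto simp: nsets_def)
  also have "\<dots> = x a * weight x (nsets ?W 2)"
    by (simp add: weight_def sum_distrib_left)
  also have "\<dots> \<le> x a * ((1 - x a)\<^sup>2 / 2)"
  proof (intro mult_left_mono)
    have "0 \<le> (\<Sum>v\<in>?W. (x v)\<^sup>2)" by (intro sum_nonneg) simp
    then show "weight x (nsets ?W 2) \<le> (1 - x a)\<^sup>2 / 2"
      using weight_nsets_2[of ?W x] assms(1) sum_W by simp
  qed (use assms in auto)
  also have "\<dots> \<le> 2 / 25"
  proof -
    have "x a \<le> 1"
      using member_le_sum[OF assms(2), of x] assms by auto
    \<comment> \<open>The product expands to \<open>4 / 27 - x a * (1 - x a)^2\<close>; the bound
      obtained is therefore \<open>2 / 27\<close>, attained at \<open>1 / 3\<close>.\<close>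
    then have "0 \<le> (x a - 1 / 3)\<^sup>2 * (4 / 3 - x a)"
      by (intro mult_nonneg_nonneg) auto
    then show ?thesis
      by (simp add: field_simps power2_eq_square)
  qed
  finally show ?thesis .
qed

text \<open>Edges through \<open>i\<close> and edges through \<open>j\<close> form disjoint
  families, so there is no mixed term. The two sums are the partial derivatives at \<open>i\<close>
  and \<open>j\<close> and involve neither \<open>x i\<close> nor \<open>x j\<close>.\<close>

lemma weight_split_uncovered:
  fixes x :: "'a \<Rightarrow> real"
  assumes "finite V" "G \<subseteq> nsets V k" "i \<noteq> j" "\<not> covered G i j"
  shows "weight x G = weight x {e \<in> G. i \<notin> e \<and> j \<notin> e} +
    x i * (\<Sum>e\<in>{e \<in> G. i \<in> e}. \<Prod>v\<in>e - {i}. x v) + x j * (\<Sum>e\<in>{e \<in> G. j \<in> e}. \<Prod>v\<in>e - {j}. x v)"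
proof -
  have fin: "finite G"
    using assms finite_imp_finite_nsets finite_subset by metis
  have fine: "finite e" if "e \<in> G" for e
    using that assms by (auto simp: nsets_def)
  have "G - {e \<in> G. i \<notin> e \<and> j \<notin> e} = {e \<in> G. i \<in> e} \<union> {e \<in> G. j \<in> e}"
    by auto
  moreover have "weight x ({e \<in> G. i \<in> e} \<union> {e \<in> G. j \<in> e}) =
      weight x {e \<in> G. i \<in> e} + weight x {e \<in> G. j \<in> e}"
    unfolding weight_def
    by (rule sum.union_disjoint) (use fin assms in \<open>auto simp: covered_def\<close>)
  moreover have "weight x G =
      weight x {e \<in> G. i \<notin> e \<and> j \<notin> e} + weight x (G - {e \<in> G. i \<notin> e \<and> j \<notin> e})"
    unfolding weight_def
    using sum.subset_diff[of "{e \<in> G. i \<notin> e \<and> j \<notin> e}" G "prod x"] fin by simp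
  moreover have "weight x {e \<in> G. u \<in> e} = x u * (\<Sum>e\<in>{e \<in> G. u \<in> e}. \<Prod>v\<in>e - {u}. x v)" for u
    unfolding weight_def sum_distrib_left
    by (rule sum.cong) (auto intro: prod.remove fine)
  ultimately show ?thesis by simp
qed

text \<open>If no edge contains both \<open>i\<close> and \<open>j\<close>, the weight is linear along \<open>(x i + t, x j - t)\<close>.\<close>

lemma merge_uncovered:
  assumes "finite V" "G \<subseteq> nsets V k" "i \<in> V" "j \<in> V" "i \<noteq> j" "\<not> covered G i j"
    and "\<And>v. v \<in> V \<Longrightarrow> 0 \<le> x v"
  obtains u y where "u \<in> V" "\<And>v. v \<in> V \<Longrightarrow> 0 \<le> y v" "sum y (V - {u}) = sum x V"
    "weight x G \<le> weight y {e \<in> G. u \<notin> e}"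
proof -
  note result = that
  define D where "D u = (\<Sum>e\<in>{e \<in> G. u \<in> e}. \<Prod>v\<in>e - {u}. x v)" for u
  \<comment> \<open>All weight goes to the vertex with the larger partial derivative, and the other
    one is discarded. Stating this for arbitrary \<open>i\<close> and \<open>j\<close> lets both
    orders of the derivatives use it.\<close>
  have main: thesis if ij: "i \<in> V" "j \<in> V" "i \<noteq> j" "\<not> covered G i j" and le: "D j \<le> D i" for i j
  proof (rule result)
    let ?y = "x(i := x i + x j)"
    let ?H = "{e \<in> G. j \<notin> e}"
    show "j \<in> V" by fact
    show "0 \<le> ?y v" if "v \<in> V" for v
      using that assms(7) ij by auto
    have "sum ?y (V - {j}) = ?y i + sum ?y (V - {j} - {i})"
      using ij assms by (intro sum.remove) auto
    also have "sum ?y (V - {j} - {i}) = sum x (V - {j} - {i})"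
      by (rule sum.cong) auto
    also have "?y i + \<dots> = x j + (x i + sum x (V - {j} - {i}))" by simp
    also have "x i + sum x (V - {j} - {i}) = sum x (V - {j})"
      using ij assms by (intro sum.remove[symmetric]) auto
    also have "x j + \<dots> = sum x V"
      using ij assms by (intro sum.remove[symmetric]) auto
    finally show "sum ?y (V - {j}) = sum x V" .
    have "weight x G = weight x {e \<in> G. i \<notin> e \<and> j \<notin> e} + x i * D i + x j * D j"
      unfolding D_def by (rule weight_split_uncovered) (use ij assms in auto)
    also have "\<dots> \<le> weight x {e \<in> G. i \<notin> e \<and> j \<notin> e} + (x i + x j) * D i"
      using mult_left_mono[OF le, of "x j"] assms(7)[OF ij(2)] by (simp add: algebra_simps)
    \<comment> \<open>This is the decomposition of \<open>weight ?y ?H\<close>, to be read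
      backwards: its \<open>j\<close> term is an empty sum, and \<open>D i\<close> is unchanged
      because no edge through \<open>i\<close> contains \<open>j\<close>.\<close>
    also have "\<dots> = weight ?y {e \<in> ?H. i \<notin> e \<and> j \<notin> e} +
       ?y i * (\<Sum>e\<in>{e \<in> ?H. i \<in> e}. \<Prod>v\<in>e - {i}. ?y v) + ?y j * (\<Sum>e\<in>{e \<in> ?H. j \<in> e}. \<Prod>v\<in>e - {j}. ?y v)"
    proof -
      have "weight x {e \<in> G. i \<notin> e \<and> j \<notin> e} = weight ?y {e \<in> ?H. i \<notin> e \<and> j \<notin> e}"
        unfolding weight_def by (intro sum.cong prod.cong) auto
      moreover have "D i = (\<Sum>e\<in>{e \<in> ?H. i \<in> e}. \<Prod>v\<in>e - {i}. ?y v)"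
        unfolding D_def using ij by (intro sum.cong prod.cong) (auto simp: covered_def)
      moreover have "{e \<in> ?H. j \<in> e} = {}" by auto
      ultimately show ?thesis by (simp only: sum.empty) simp
    qed
    also have "\<dots> = weight ?y ?H"
      by (rule weight_split_uncovered[symmetric, of V _ k])
         (use ij assms in \<open>auto simp: covered_def\<close>)
    finally show "weight x G \<le> weight ?y ?H" .
  qed
  have "\<not> covered G j i"
    using assms by (simp add: covered_def insert_commute)
  then show thesis
    using main[of i j] main[of j i] assms(3-6) linear[of "D i" "D j"] by blast
qed

section \<open>Shifting\<close>

text \<open>The compression of extremal set theory. A set stays where it is if its target is already
  occupied, so that no edges are lost.\<close>

definition shift :: "'a \<Rightarrow> 'a \<Rightarrow> 'a set set \<Rightarrow> 'a set \<Rightarrow> 'a set" where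
  "shift u v G e =
     (if v \<in> e \<and> u \<notin> e \<and> insert u (e - {v}) \<notin> G then insert u (e - {v}) else e)"

text \<open>Moved sets land outside \<open>G\<close> and unmoved ones remain in \<open>G\<close>, so
  the two kinds cannot collide; a moved set is recovered by exchanging \<open>u\<close> and
  \<open>v\<close> back.\<close>

lemma inj_on_shift: "inj_on (shift u v G) G"
proof (rule inj_onI)
  fix e f assume "e \<in> G" "f \<in> G" "shift u v G e = shift u v G f"
  then consider "v \<in> e \<and> v \<in> f \<and> u \<notin> e \<and> u \<notin> f \<and> insert u (e - {v}) = insert u (f - {v})" | "e = f"
    by (auto simp: shift_def split: if_splits)
  then show "e = f"
  proof cases
    case 1
    then have "e = insert v (insert u (e - {v}) - {u})" "f = insert v (insert u (f - {v}) - {u})"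
      by auto
    with 1 show ?thesis by metis
  qed
qed

text \<open>The critical case is a moved \<open>e\<close> that meets an unmoved \<open>f\<close> in
  \<open>v\<close>, with \<open>u\<close> not in \<open>f\<close>. Then \<open>f\<close> was blocked
  by \<open>insert u (f - {v})\<close> in \<open>G\<close>, and \<open>e\<close> meets that set in a
  point other than \<open>u\<close> and \<open>v\<close>.\<close>

lemma intersecting_shift:
  assumes "intersecting G" "u \<noteq> v"
  shows "intersecting (shift u v G ` G)"
proof -
  have *: "shift u v G e \<inter> shift u v G f \<noteq> {}"
    if ef: "e \<in> G" "f \<in> G" and moved: "shift u v G e \<noteq> e" for e f
  proof -
    have e: "v \<in> e" "u \<notin> e" "shift u v G e = insert u (e - {v})"
      using moved by (auto simp: shift_def split: if_splits)
    obtain w where w: "w \<in> e" "w \<in> f"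
      using assms ef by (auto simp: intersecting_def)
    show ?thesis
    proof (cases "u \<in> shift u v G f \<or> w \<noteq> v")
      case True
      with e w show ?thesis by (auto simp: shift_def)
    next
      case False
      then have "insert u (f - {v}) \<in> G" "shift u v G f = f"
        using w by (auto simp: shift_def split: if_splits)
      then obtain w' where "w' \<in> e" "w' \<in> insert u (f - {v})"
        using assms ef by (meson disjoint_iff intersecting_def)
      then show ?thesis
        using e \<open>shift u v G f = f\<close> by auto
    qed
  qed
  show ?thesis
    unfolding intersecting_def
  proof (intro ballI)
    fix e' f' assume "e' \<in> shift u v G ` G" "f' \<in> shift u v G ` G"
    then obtain e f where ef: "e \<in> G" "f \<in> G" and "e' = shift u v G e" "f' = shift u v G f"
      by blast
    then show "e' \<inter> f' \<noteq> {}"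
      using *[of e f] *[of f e] assms(1)
      by (cases "shift u v G e = e"; cases "shift u v G f = f")
         (auto simp: intersecting_def Int_commute)
  qed
qed

text \<open>A moved edge trades the factor \<open>x v\<close> for \<open>x u\<close>, and
  injectivity keeps the number of edges.\<close>

lemma weight_shift:
  assumes "finite V" "G \<subseteq> nsets V k" "\<And>w. w \<in> V \<Longrightarrow> 0 \<le> x w" "x v \<le> x u"
  shows "weight x G \<le> weight x (shift u v G ` G)"
  unfolding weight_def sum.reindex[OF inj_on_shift] o_def
proof (rule sum_mono)
  fix e assume "e \<in> G"
  with assms have e: "finite e" "e \<subseteq> V" by (auto simp: nsets_def)
  show "prod x e \<le> prod x (shift u v G e)"
  proof (cases "shift u v G e = e")
    case False
    then have m: "v \<in> e" "u \<notin> e" "shift u v G e = insert u (e - {v})"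
      by (auto simp: shift_def split: if_splits)
    have "prod x e = x v * prod x (e - {v})"
      using e m by (intro prod.remove) auto
    also have "\<dots> \<le> x u * prod x (e - {v})"
      using e assms by (intro mult_right_mono prod_nonneg) auto
    also have "\<dots> = prod x (shift u v G e)"
      using e m by simp
    finally show ?thesis .
  qed simp
qed

text \<open>The measure that makes repeated shifting terminate.\<close>

lemma sum_shift_less:
  fixes r :: "'a \<Rightarrow> nat"
  assumes "finite G" "\<And>e. e \<in> G \<Longrightarrow> finite e" "r u < r v"
    and "e \<in> G" "v \<in> e" "u \<notin> e" "insert u (e - {v}) \<notin> G"
  shows "(\<Sum>e\<in>shift u v G ` G. sum r e) < (\<Sum>e\<in>G. sum r e)"
  unfolding sum.reindex[OF inj_on_shift] o_def
proof (rule sum_strict_mono_ex1)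
  have *: "sum r (insert u (f - {v})) < sum r f" if "f \<in> G" "v \<in> f" "u \<notin> f" for f
  proof -
    have "sum r f = r v + sum r (f - {v})" "sum r (insert u (f - {v})) = r u + sum r (f - {v})"
      using that assms(2) by (auto intro: sum.remove)
    with assms(3) show ?thesis by linarith
  qed
  show "\<forall>f\<in>G. sum r (shift u v G f) \<le> sum r f"
    using * by (auto simp: shift_def intro: less_imp_le)
  show "\<exists>f\<in>G. sum r (shift u v G f) < sum r f"
    using * assms(4-) by (auto simp: shift_def intro!: bexI[of _ e])
qed fact

text \<open>Shifts towards lower rank are applied as long as one of them changes the family. Lower
  rank means at least as much weight, so no shift decreases the weight.\<close>

lemma obtain_shifted:
  fixes r :: "'a \<Rightarrow> nat"
  assumes "finite V" "G \<subseteq> nsets V k" "intersecting G" "\<And>w. w \<in> V \<Longrightarrow> 0 \<le> x w"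
    and "\<And>u v. u \<in> V \<Longrightarrow> v \<in> V \<Longrightarrow> r u < r v \<Longrightarrow> x v \<le> x u"
  obtains H where "H \<subseteq> nsets V k" "intersecting H" "weight x G \<le> weight x H"
    "\<And>u v e. u \<in> V \<Longrightarrow> r u < r v \<Longrightarrow> e \<in> H \<Longrightarrow> v \<in> e \<Longrightarrow> u \<notin> e \<Longrightarrow> insert u (e - {v}) \<in> H"
  using assms(2,3)
proof (induction "\<Sum>e\<in>G. sum r e" arbitrary: G thesis rule: less_induct)
  case less
  show ?case
  proof (cases "\<forall>u v e. u \<in> V \<longrightarrow> r u < r v \<longrightarrow> e \<in> G \<longrightarrow> v \<in> e \<longrightarrow> u \<notin> e \<longrightarrow> insert u (e - {v}) \<in> G")
    case True
    then show ?thesis by (intro less.prems(1)[of G] less.prems(2,3) order_refl) blast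
  next
    case False
    then obtain u v e where uv: "u \<in> V" "r u < r v"
      and e: "e \<in> G" "v \<in> e" "u \<notin> e" "insert u (e - {v}) \<notin> G" by blast
    have v: "v \<in> V" using e less.prems(2,3) by (auto simp: nsets_def)
    have fin: "finite G"
      using assms(1) less.prems(2,3) finite_imp_finite_nsets finite_subset by metis
    let ?G = "shift u v G ` G"
    have "(\<Sum>e\<in>?G. sum r e) < (\<Sum>e\<in>G. sum r e)"
      by (rule sum_shift_less) (use fin uv e less.prems(2,3) in \<open>auto simp: nsets_def\<close>)
    moreover have "?G \<subseteq> nsets V k"
    proof
      fix f' assume "f' \<in> ?G"
      then obtain f where f: "f \<in> G" "f' = shift u v G f" by (elim imageE)
      then have "f \<subseteq> V" "finite f" "card f = k" using less.prems(2) by (auto simp: nsets_def)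
      moreover have "card (insert u (f - {v})) = card f" if "v \<in> f" "u \<notin> f"
        using that \<open>finite f\<close> card_Suc_Diff1[of f v] by simp
      ultimately show "f' \<in> nsets V k"
        using f(2) uv v by (auto simp: shift_def nsets_def)
    qed
    moreover have "intersecting ?G"
      using uv less.prems(2,3) by (intro intersecting_shift) auto
    moreover have "weight x G \<le> weight x ?G"
      by (rule weight_shift) (use assms uv v less.prems(2,3) in auto)
    ultimately show ?thesis
    proof (elim less.hyps)
      fix H assume "weight x ?G \<le> weight x H" "weight x G \<le> weight x ?G"
      then have "weight x G \<le> weight x H" by linarith
      moreover assume "H \<subseteq> nsets V k" "intersecting H"
        "\<And>u v e. u \<in> V \<Longrightarrow> r u < r v \<Longrightarrow> e \<in> H \<Longrightarrow> v \<in> e \<Longrightarrow> u \<notin> e \<Longrightarrow>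
          insert u (e - {v}) \<in> H"
      ultimately show thesis by (intro less.prems(1))
    qed
  qed
qed

text \<open>Injectivity breaks ties, so shifting also decides between vertices of equal weight;
  values in the naturals make the rank sum a termination measure.\<close>

lemma obtain_rank:
  fixes x :: "'a \<Rightarrow> real"
  assumes "finite V"
  obtains r :: "'a \<Rightarrow> nat" where "inj_on r V"
    "\<And>u v. u \<in> V \<Longrightarrow> v \<in> V \<Longrightarrow> r u < r v \<Longrightarrow> x v \<le> x u"
proof -
  have "\<exists>r::'a \<Rightarrow> nat. inj_on r V \<and> r ` V \<subseteq> {..<card V} \<and>
      (\<forall>u\<in>V. \<forall>v\<in>V. r u < r v \<longrightarrow> x v \<le> x u)"
    using assms
  \<comment> \<open>The rule inserts a vertex of least weight, which receives the next free rank. It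
    allows the new vertex to lie in \<open>S\<close> already.\<close>
  proof (induction V rule: finite_ranking_induct[where f = "\<lambda>v. - x v"])
    case (insert y S)
    then obtain r :: "'a \<Rightarrow> nat" where r: "inj_on r S" "r ` S \<subseteq> {..<card S}"
      "\<forall>u\<in>S. \<forall>v\<in>S. r u < r v \<longrightarrow> x v \<le> x u" by blast
    show ?case
    proof (cases "y \<in> S")
      case True
      with r show ?thesis by (auto simp: insert_absorb)
    next
      case False
      let ?r = "r(y := card S)"
      have lt: "r u < card S" if "u \<in> S" for u using r(2) that by auto
      have "inj_on ?r (insert y S)"
        using r(2) False inj_on_fun_updI[OF r(1), of "card S" y] by (auto simp: inj_on_insert)
      moreover have "?r ` insert y S \<subseteq> {..<card (insert y S)}"
        using lt False insert(1) by (auto simp: less_Suc_eq)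
      moreover have "x v \<le> x u" if "u \<in> insert y S" "v \<in> insert y S" "?r u < ?r v" for u v
      proof (cases "v = y")
        case True
        with that insert(2)[of u] show ?thesis by auto
      next
        case False
        then have "v \<in> S" using that by simp
        with False that lt[of v] have "u \<noteq> y" by auto
        with False that r(3) show ?thesis by auto
      qed
      ultimately show ?thesis by blast
    qed
  qed auto
  then obtain r :: "'a \<Rightarrow> nat" where "inj_on r V" "\<forall>u\<in>V. \<forall>v\<in>V. r u < r v \<longrightarrow> x v \<le> x u"
    by blast
  then show thesis by (intro that[of r]) auto
qed

text \<open>If all pairs are covered and there are at least six vertices, the set consisting of the first
  and the last two vertices is an edge, and an edge avoiding the first vertex could be shifted away
  from it.\<close>

lemma shifted_intersecting_star:
  fixes r :: "'a \<Rightarrow> nat"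
  assumes "finite V" "6 \<le> card V" "inj_on r V" "H \<subseteq> nsets V 3" "intersecting H"
    and shifted: "\<And>u v e. u \<in> V \<Longrightarrow> r u < r v \<Longrightarrow> e \<in> H \<Longrightarrow> v \<in> e \<Longrightarrow> u \<notin> e \<Longrightarrow>
      insert u (e - {v}) \<in> H"
    and covered: "\<And>u v. u \<in> V \<Longrightarrow> v \<in> V \<Longrightarrow> u \<noteq> v \<Longrightarrow> covered H u v"
  obtains a where "a \<in> V" "\<And>e. e \<in> H \<Longrightarrow> a \<in> e"
proof -
  have ex_max: "\<exists>w\<in>W. \<forall>t\<in>W - {w}. r t < r w" if W: "W \<subseteq> V" "W \<noteq> {}" for W
  proof -
    have "finite W" using W assms(1) finite_subset by blast
    then have "Max (r ` W) \<in> r ` W" using W(2) by simp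
    then obtain w where "w \<in> W" "Max (r ` W) = r w" by (elim imageE)
    then have w: "w \<in> W" "\<forall>t\<in>W. r t \<le> r w"
      using \<open>finite W\<close> by (auto simp flip: \<open>Max (r ` W) = r w\<close>)
    have "r t < r w" if "t \<in> W - {w}" for t
    proof -
      have "r t \<noteq> r w"
        using assms(3) W w(1) that by (auto dest: inj_onD)
      with w that show ?thesis by (simp add: less_le)
    qed
    with w show ?thesis by blast
  qed
  have "V \<noteq> {}" using assms(2) by auto
  \<comment> \<open>\<open>w\<close> and \<open>u\<close> have the highest and second highest rank,
    and \<open>a\<close> below has the lowest.\<close>
  then obtain w where w: "w \<in> V" "\<forall>t\<in>V - {w}. r t < r w"
    using ex_max by blast
  have "V - {w} \<noteq> {}"
    using assms(1,2) w(1) card_Diff_singleton[of w V] by (intro notI) simp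
  then obtain u where u: "u \<in> V - {w}" "\<forall>t\<in>V - {w} - {u}. r t < r u"
    using ex_max[of "V - {w}"] by blast
  obtain a where a: "a \<in> V" "\<forall>t\<in>V. r a \<le> r t"
    using \<open>V \<noteq> {}\<close> ex_has_least_nat[of "\<lambda>v. v \<in> V" _ r] by blast
  have "card (V - {w, u}) \<ge> 4"
    using u w assms(1,2) by (auto simp: card_Diff_subset card_insert_if)
  then have "V - {w, u} \<noteq> {}" by (metis card.empty not_numeral_le_zero)
  then obtain t where t: "t \<in> V" "t \<noteq> w" "t \<noteq> u" by auto
  then have "r t < r w" "r t < r u" using u w by auto
  then have "a \<noteq> w" "a \<noteq> u" using a(2) t(1) by (metis leD)+
  \<comment> \<open>Some edge covers the pair \<open>u\<close>, \<open>w\<close>, and its third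
    vertex can be shifted to \<open>a\<close>.\<close>
  have auw: "{a, u, w} \<in> H"
  proof -
    obtain e where e: "e \<in> H" "u \<in> e" "w \<in> e"
      using covered[of u w] u w by (auto simp: covered_def)
    then have "card e = 3" "finite e" "e \<subseteq> V" using assms(4) by (auto simp: nsets_def)
    then have "card (e - {u, w}) = 1" using e u by (auto simp: card_Diff_subset card_insert_if)
    then obtain t where t: "e - {u, w} = {t}" by (auto simp: card_1_singleton_iff)
    then have et: "e = {t, u, w}" "t \<noteq> u" "t \<noteq> w" using e by auto
    show ?thesis
    proof (cases "t = a")
      case True
      with e et show ?thesis by simp
    next
      case False
      have "t \<in> V" using \<open>e \<subseteq> V\<close> et by auto
      then have "r a < r t"
        using False a assms(3) by (metis inj_on_def le_neq_implies_less)
      then have "insert a (e - {t}) \<in> H"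
        using False a(1) \<open>a \<noteq> w\<close> \<open>a \<noteq> u\<close> e(1) et by (intro shifted) auto
      moreover have "insert a (e - {t}) = {a, u, w}" using et by auto
      ultimately show ?thesis by simp
    qed
  qed
  \<comment> \<open>An edge avoiding \<open>a\<close> must meet \<open>{a, u, w}\<close> in some
    \<open>v\<close> among \<open>u\<close> and \<open>w\<close>. Shifting \<open>v\<close> to a
    vertex outside \<open>f\<close> and \<open>{a, u, w}\<close> gives another edge avoiding
    \<open>a\<close> with fewer points in \<open>{u, w}\<close>.\<close>
  have "a \<in> f" if "f \<in> H" for f
    using that
  proof (induction "card (f \<inter> {u, w})" arbitrary: f rule: less_induct)
    case less
    show "a \<in> f"
    proof (rule ccontr)
      assume af: "a \<notin> f"
      have f: "f \<subseteq> V" "finite f" "card f = 3" using less.prems assms(4) by (auto simp: nsets_def)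
      have "f \<inter> {a, u, w} \<noteq> {}"
        using assms(5)[unfolded intersecting_def, rule_format, OF less.prems auw] .
      then obtain v where v: "v \<in> f" "v = u \<or> v = w"
        using af by auto
      \<comment> \<open>As \<open>v\<close> is counted in \<open>f\<close>, the union has at most 2
        + 3 elements. A sixth vertex of \<open>V\<close> is what provides \<open>t\<close>.\<close>
      have "card (insert a ({u, w} \<union> f)) \<le> 5"
      proof -
        have "insert a ({u, w} \<union> f) = ({a, u, w} - {v}) \<union> f" using v by auto
        moreover have "card ({a, u, w} - {v}) \<le> 2"
          using v \<open>a \<noteq> w\<close> \<open>a \<noteq> u\<close> u by (auto simp: card_insert_if)
        ultimately show ?thesis
          using card_Un_le[of "{a, u, w} - {v}" f] f by simp
      qed
      then have "\<not> V \<subseteq> insert a ({u, w} \<union> f)"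
        using assms(2) f(2) card_mono[of "insert a ({u, w} \<union> f)" V] by auto
      then obtain t where t: "t \<in> V" "t \<noteq> a" "t \<noteq> u" "t \<noteq> w" "t \<notin> f" by auto
      then have "r t < r v" using u w v by auto
      then have in_H: "insert t (f - {v}) \<in> H" using less.prems t(1,5) v(1) by (intro shifted)
      have "insert t (f - {v}) \<inter> {u, w} = f \<inter> {u, w} - {v}" using t by auto
      then have "card (insert t (f - {v}) \<inter> {u, w}) < card (f \<inter> {u, w})"
        using v card_Diff1_less[of "f \<inter> {u, w}" v] by simp
      from less.hyps[OF this in_H] show False using af t by auto
    qed
  qed
  with a(1) show thesis by (rule that)
qed

text \<open>Induction on the number of vertices. Merging is needed for \<open>G\<close> and again
  for the shifted \<open>H\<close>, since shifting may uncover pairs; \<open>H\<close> is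
  \<open>hom_free\<close> because shifting keeps it \<open>intersecting\<close>.\<close>

lemma lagrangian_le:
  assumes "finite V" "G \<subseteq> nsets V 3" "hom_free G" "\<And>v. v \<in> V \<Longrightarrow> 0 \<le> x v" "sum x V = 1"
  shows "weight x G \<le> 2 / 25"
  using assms
proof (induction "card V" arbitrary: V G x rule: less_induct)
  case less
  have merge: "weight x H \<le> 2 / 25"
    if H: "H \<subseteq> nsets V 3" "hom_free H" and ij: "i \<in> V" "j \<in> V" "i \<noteq> j" "\<not> covered H i j" for H i j
  proof -
    obtain u y where u: "u \<in> V" and y: "\<And>v. v \<in> V \<Longrightarrow> 0 \<le> y v" "sum y (V - {u}) = sum x V"
      "weight x H \<le> weight y {e \<in> H. u \<notin> e}"
      by (rule merge_uncovered[OF less.prems(1) H(1) ij, of x]) (rule less.prems(4), assumption, rule that)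
    have "weight y {e \<in> H. u \<notin> e} \<le> 2 / 25"
    proof (rule less.hyps)
      show "card (V - {u}) < card V" using u less.prems(1) by (rule card_Diff1_less[rotated])
      show "{e \<in> H. u \<notin> e} \<subseteq> nsets (V - {u}) 3" using H by (auto simp: nsets_def)
      show "hom_free {e \<in> H. u \<notin> e}" by (rule hom_free_subset[OF H(2)]) auto
    qed (use y less.prems in auto)
    with y show ?thesis by linarith
  qed
  show ?case
  proof (cases "\<forall>i\<in>V. \<forall>j\<in>V. i \<noteq> j \<longrightarrow> covered G i j")
    case False
    then show ?thesis using merge[OF less.prems(2,3)] by metis
  next
    case True
    have "intersecting G"
      unfolding intersecting_def
    proof (intro ballI notI)
      fix e f assume ef: "e \<in> G" "f \<in> G" "e \<inter> f = {}"
      then obtain u v where "u \<in> e" "v \<in> f" "\<not> covered G u v"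
        using less.prems(3) unfolding hom_free_def by blast
      moreover have "e \<subseteq> V" "f \<subseteq> V" using ef less.prems(2) by (auto simp: nsets_def)
      ultimately show False using True ef(3) by (metis disjoint_iff subsetD)
    qed
    obtain r :: "'a \<Rightarrow> nat" where r: "inj_on r V"
      "\<And>u v. u \<in> V \<Longrightarrow> v \<in> V \<Longrightarrow> r u < r v \<Longrightarrow> x v \<le> x u"
      using obtain_rank[OF less.prems(1)] by blast
    obtain H where H: "H \<subseteq> nsets V 3" "intersecting H" "weight x G \<le> weight x H"
      "\<And>u v e. u \<in> V \<Longrightarrow> r u < r v \<Longrightarrow> e \<in> H \<Longrightarrow> v \<in> e \<Longrightarrow> u \<notin> e \<Longrightarrow> insert u (e - {v}) \<in> H"
      by (rule obtain_shifted[OF less.prems(1,2) \<open>intersecting G\<close>, where x = x and r = r])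
         (rule less.prems(4), assumption, rule r(2), assumption+, rule that)
    have "weight x H \<le> 2 / 25"
    proof (cases "\<forall>i\<in>V. \<forall>j\<in>V. i \<noteq> j \<longrightarrow> covered H i j")
      case False
      then show ?thesis using merge[OF H(1) intersecting_imp_hom_free[OF H(2)]] by metis
    next
      case True
      show ?thesis
      proof (cases "card V \<le> 5")
        case True
        then show ?thesis using less.prems H by (intro weight_le_of_card_le_5)
      next
        case False
        obtain a where "a \<in> V" "\<And>e. e \<in> H \<Longrightarrow> a \<in> e"
          by (rule shifted_intersecting_star[OF less.prems(1) _ r(1) H(1,2,4)])
             (use False \<open>\<forall>i\<in>V. \<forall>j\<in>V. i \<noteq> j \<longrightarrow> covered H i j\<close> in auto)
        then show ?thesis using less.prems H by (intro weight_star_le)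
      qed
    qed
    with H show ?thesis by linarith
  qed
qed

section \<open>The upper bound\<close>

text \<open>While some pair inside an edge lies in at most \<open>d\<close> edges, these edges are
  deleted. The pair then stays uncovered, so each pair is charged at most once; the number of
  covered pairs, \<open>card (C G)\<close>, is the induction measure.\<close>

lemma obtain_high_codegree:
  assumes "finite V" "G \<subseteq> nsets V 3"
  obtains H where "H \<subseteq> G" "card G \<le> card H + d * (card V)\<^sup>2"
    "\<And>e p. e \<in> H \<Longrightarrow> p \<subseteq> e \<Longrightarrow> card p = 2 \<Longrightarrow> d < card {e \<in> H. p \<subseteq> e}"
proof -
  define C where "C G = {p \<in> nsets V 2. \<exists>e\<in>G. p \<subseteq> e}" for G
  let ?good = "\<lambda>H. \<forall>e\<in>H. \<forall>p. p \<subseteq> e \<longrightarrow> card p = 2 \<longrightarrow> d < card {e \<in> H. p \<subseteq> e}"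
  have fin: "finite (C G)" for G
    using finite_imp_finite_nsets[OF assms(1)] by (simp add: C_def)
  have "\<exists>H\<subseteq>G. card G \<le> card H + d * card (C G) \<and> ?good H"
    using assms(2)
  proof (induction "card (C G)" arbitrary: G rule: less_induct)
    case less
    have finG: "finite G"
      using less.prems finite_imp_finite_nsets[OF assms(1)] by (rule finite_subset)
    show ?case
    proof (cases "?good G")
      case True
      then show ?thesis by (intro exI[of _ G]) simp
    next
      case False
      then obtain e p where ep: "e \<in> G" "p \<subseteq> e" "card p = 2" "card {e \<in> G. p \<subseteq> e} \<le> d"
        by (auto simp: not_less)
      let ?D = "{e \<in> G. p \<subseteq> e}"
      have "p \<in> C G"
        using ep less.prems finite_subset[of p e] by (auto simp: C_def nsets_def)
      moreover have "p \<notin> C (G - ?D)" by (auto simp: C_def)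
      moreover have "C (G - ?D) \<subseteq> C G" by (auto simp: C_def)
      ultimately have "C (G - ?D) \<subset> C G" by (metis psubsetI)
      then have lt: "card (C (G - ?D)) < card (C G)"
        by (rule psubset_card_mono[OF fin])
      then obtain H where H: "H \<subseteq> G - ?D" "card (G - ?D) \<le> card H + d * card (C (G - ?D))"
        "?good H"
        using less.hyps[of "G - ?D"] less.prems by (meson Diff_subset subset_trans)
      have "card G = card (G - ?D) + card ?D"
        using finG by (simp add: card_Diff_subset card_mono)
      also have "\<dots> \<le> card H + d * Suc (card (C (G - ?D)))"
        using H(2) ep(4) by simp
      also have "\<dots> \<le> card H + d * card (C G)"
        using lt by (intro add_left_mono mult_le_mono2) simp
      finally have "card G \<le> card H + d * card (C G)" .
      moreover have "H \<subseteq> G" using H(1) by auto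
      ultimately show ?thesis using H(3) by (intro exI[of _ H] conjI)
    qed
  qed
  then obtain H where H: "H \<subseteq> G" "card G \<le> card H + d * card (C G)" "?good H"
    by (elim exE conjE)
  have "card (C G) \<le> card (nsets V 2)"
    using finite_imp_finite_nsets[OF assms(1)] by (intro card_mono) (auto simp: C_def)
  also have "\<dots> \<le> (card V)\<^sup>2"
    using binomial_le_pow[of 2 "card V"] by (cases "2 \<le> card V") (simp_all add: not_le binomial_eq_0)
  finally have "d * card (C G) \<le> d * (card V)\<^sup>2" by simp
  with H(2) have "card G \<le> card H + d * (card V)\<^sup>2" by linarith
  with H(1,3) show thesis by (intro that[of H]) auto
qed

text \<open>A crude form of Hall's condition: fewer than \<open>card (S j)\<close> values have been
  used when \<open>j\<close> is reached.\<close>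

lemma greedy_distinct_representatives:
  assumes "finite I" "\<And>i. i \<in> I \<Longrightarrow> finite (S i) \<and> card I \<le> card (S i)"
  shows "\<exists>z. inj_on z I \<and> (\<forall>i\<in>I. z i \<in> S i)"
  using assms
proof (induction I rule: finite_induct)
  case (insert j I)
  have "\<exists>z. inj_on z I \<and> (\<forall>i\<in>I. z i \<in> S i)"
    using insert by (intro insert.IH) force
  then obtain z where z: "inj_on z I" "\<forall>i\<in>I. z i \<in> S i"
    by (elim exE conjE)
  have "card (z ` I) < card (S j)"
    using insert.prems[of j] insert(1,2) card_image_le[OF insert(1), of z] by simp
  then have "\<not> S j \<subseteq> z ` I"
    using insert(1) card_mono[of "z ` I" "S j"] by auto
  then obtain s where s: "s \<in> S j" "s \<notin> z ` I" by auto
  have "inj_on (z(j := s)) (insert j I)"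
    using s(2) insert(2) inj_on_fun_updI[OF z(1) s(2), of j] by (auto simp: inj_on_insert)
  moreover have "\<forall>i\<in>insert j I. (z(j := s)) i \<in> S i"
    using s z insert(2) by auto
  ultimately show ?case by (intro exI[of _ "z(j := s)"] conjI)
qed simp

text \<open>Indexing \<open>z\<close> by pairs makes the distinctness of the nine third vertices a
  single injectivity condition.\<close>

lemma contains_K333I:
  fixes a b :: "nat \<Rightarrow> 'a" and z :: "nat \<times> nat \<Rightarrow> 'a"
  assumes "three_graph G"
    and "a ` {1..3} \<in> edges G" "b ` {1..3} \<in> edges G"
    and "\<And>i j. i \<in> {1..3} \<Longrightarrow> j \<in> {1..3} \<Longrightarrow> {a i, b j, z (i, j)} \<in> edges G"
    and "inj_on a {1..3}" "inj_on b {1..3}" "inj_on z ({1..3} \<times> {1..3})"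
    and "a ` {1..3} \<inter> b ` {1..3} = {}"
    and "z ` ({1..3} \<times> {1..3}) \<inter> (a ` {1..3} \<union> b ` {1..3}) = {}"
  shows "contains_copy G K333"
proof -
  let ?f = "\<lambda>v. case v of X i \<Rightarrow> a i | Y j \<Rightarrow> b j | Z i j \<Rightarrow> z (i, j)"
  let ?ZZ = "{Z i j |i j. i \<in> {1..3} \<and> j \<in> {1..3}}"
  have V: "vertices K333 = X ` {1..3} \<union> Y ` {1..3} \<union> ?ZZ"
    by (simp add: K333_def vertices_def)
  have fZ: "?f ` ?ZZ = z ` ({1..3} \<times> {1..3})"
    by (auto simp: image_iff) (metis atLeastAtMost_iff kvertex.simps(12))+
  have fX: "?f ` X ` {1..3} = a ` {1..3}" and fY: "?f ` Y ` {1..3} = b ` {1..3}"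
    by (simp_all add: image_image)
  have sub: "e \<subseteq> vertices G" if "e \<in> edges G" for e
    using assms(1) that by (simp add: three_graph_def)
  have iX: "inj_on ?f (X ` {1..3})" and iY: "inj_on ?f (Y ` {1..3})" and iZ: "inj_on ?f ?ZZ"
    using assms(5-7) unfolding inj_on_def by (auto; metis)+
  have inj_Un: "inj_on g (A \<union> B)" if "inj_on g A" "inj_on g B" "g ` A \<inter> g ` B = {}"
    for g :: "kvertex \<Rightarrow> 'a" and A B
    using that by (auto simp: inj_on_Un)
  have "inj_on ?f (vertices K333)"
    unfolding V
  proof (intro inj_Un iX iY iZ)
    show "?f ` X ` {1..3} \<inter> ?f ` Y ` {1..3} = {}"
      unfolding fX fY by fact
    show "?f ` (X ` {1..3} \<union> Y ` {1..3}) \<inter> ?f ` ?ZZ = {}"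
      unfolding image_Un fX fY fZ using assms(9) by (simp only: Int_commute)
  qed
  moreover have "?f ` vertices K333 \<subseteq> vertices G"
  proof -
    have "z (i, j) \<in> vertices G" if "i \<in> {1..3}" "j \<in> {1..3}" for i j
      using sub[OF assms(4)[OF that]] by simp
    then show ?thesis
      unfolding V image_Un fX fY fZ using sub[OF assms(2)] sub[OF assms(3)] by auto
  qed
  moreover have "\<forall>e\<in>edges K333. ?f ` e \<in> edges G"
  proof
    have "{1..3::nat} = {1, 2, 3}" by auto
    then have E: "edges K333 = {X ` {1..3}, Y ` {1..3}} \<union>
        {{X i, Y j, Z i j} |i j. i \<in> {1..3} \<and> j \<in> {1..3}}"
      by (simp add: K333_def edges_def)
    fix e assume "e \<in> edges K333"
    then consider "e = X ` {1..3}" | "e = Y ` {1..3}"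
      | i j where "i \<in> {1..3}" "j \<in> {1..3}" "e = {X i, Y j, Z i j}"
      unfolding E by (elim UnE insertE emptyE CollectE exE conjE)
    then show "?f ` e \<in> edges G"
    proof cases
      case 1
      show ?thesis unfolding 1 fX by fact
    next
      case 2
      show ?thesis unfolding 2 fY by fact
    next
      case (3 i j)
      then show ?thesis using assms(4) by simp
    qed
  qed
  ultimately show ?thesis
    unfolding contains_copy_def by (intro exI[of _ ?f] conjI)
qed

text \<open>Every pair has at least \<open>15\<close> candidates for \<open>Z i j\<close>; six are lost to the \<open>X i\<close>, \<open>Y j\<close>, and
  the remaining nine suffice to choose nine distinct vertices greedily.\<close>

lemma hom_free_of_high_codegree:
  assumes "three_graph G" "H \<subseteq> edges G" "\<not> contains_copy G K333"
    and codeg: "\<And>e p. e \<in> H \<Longrightarrow> p \<subseteq> e \<Longrightarrow> card p = 2 \<Longrightarrow> 14 < card {e \<in> H. p \<subseteq> e}"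
  shows "hom_free H"
proof (rule ccontr)
  assume "\<not> hom_free H"
  then obtain e f where ef: "e \<in> H" "f \<in> H" "e \<inter> f = {}"
    and cov: "\<And>u v. u \<in> e \<Longrightarrow> v \<in> f \<Longrightarrow> covered H u v"
    unfolding hom_free_def by (auto simp: Bex_def)
  have H3: "finite e \<and> e \<subseteq> vertices G \<and> card e = 3" if "e \<in> H" for e
    using that assms(1,2) unfolding three_graph_def by (meson finite_subset subsetD)
  have finV: "finite (vertices G)" using assms(1) by (simp add: three_graph_def)
  obtain a :: "nat \<Rightarrow> 'a" where a: "bij_betw a {1..3} e"
    using ex_bij_betw_nat_finite_1[of e] H3[OF ef(1)] by auto
  obtain b :: "nat \<Rightarrow> 'a" where b: "bij_betw b {1..3} f"
    using ex_bij_betw_nat_finite_1[of f] H3[OF ef(2)] by auto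
  let ?I = "{1..3::nat} \<times> {1..3::nat}"
  define S where "S = (\<lambda>(i, j). {z. {a i, b j, z} \<in> H} - (e \<union> f))"
  have "finite (S ij) \<and> card ?I \<le> card (S ij)" if I: "ij \<in> ?I" for ij
  proof -
    obtain i j where ij: "ij = (i, j)" "i \<in> {1..3}" "j \<in> {1..3}" using I by auto
    let ?S = "{z. {a i, b j, z} \<in> H}"
    have ab: "a i \<in> e" "b j \<in> f" using a b ij by (auto simp: bij_betw_def)
    have "a i \<noteq> b j" using ab ef(3) by auto
    have "?S \<subseteq> vertices G" using H3 by auto
    then have finS: "finite ?S" using finV finite_subset by auto
    obtain g where "g \<in> H" "{a i, b j} \<subseteq> g" using cov[OF ab] by (auto simp: covered_def)
    then have "14 < card {h \<in> H. {a i, b j} \<subseteq> h}"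
      using codeg[of g "{a i, b j}"] \<open>a i \<noteq> b j\<close> by simp
    \<comment> \<open>An edge through the pair is determined by its third vertex, so the codegree
      bounds the number of candidates from below.\<close>
    also have "\<dots> \<le> card ((\<lambda>z. {a i, b j, z}) ` ?S)"
    proof (rule card_mono)
      show "{h \<in> H. {a i, b j} \<subseteq> h} \<subseteq> (\<lambda>z. {a i, b j, z}) ` ?S"
      proof
        fix h assume h: "h \<in> {h \<in> H. {a i, b j} \<subseteq> h}"
        then have "card (h - {a i, b j}) = 1"
          using H3[of h] \<open>a i \<noteq> b j\<close> by (auto simp: card_Diff_subset)
        then obtain z where "h - {a i, b j} = {z}" by (auto simp: card_1_singleton_iff)
        then have "h = {a i, b j, z}" using h by auto
        then show "h \<in> (\<lambda>z. {a i, b j, z}) ` ?S" using h by auto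
      qed
    qed (use finS in simp)
    also have "\<dots> \<le> card ?S" by (rule card_image_le[OF finS])
    finally have "15 \<le> card ?S" by simp
    moreover have "card (e \<union> f) \<le> 6"
      using card_Un_le[of e f] H3[OF ef(1)] H3[OF ef(2)] by simp
    moreover have "card ?S - card (e \<union> f) \<le> card (?S - (e \<union> f))"
      using H3[OF ef(1)] H3[OF ef(2)] by (intro diff_card_le_card_Diff) auto
    ultimately have "9 \<le> card (?S - (e \<union> f))" by linarith
    then show ?thesis using finS by (simp add: S_def ij)
  qed
  then obtain z where z: "inj_on z ?I" "\<forall>ij\<in>?I. z ij \<in> S ij"
    using greedy_distinct_representatives[of ?I S] by auto
  have "contains_copy G K333"
  proof (rule contains_K333I[of G a b z])
    show "z ` ?I \<inter> (a ` {1..3} \<union> b ` {1..3}) = {}"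
      using a b z(2) by (force simp: bij_betw_def S_def)
    show "{a i, b j, z (i, j)} \<in> edges G" if "i \<in> {1..3}" "j \<in> {1..3}" for i j
      using z(2) that assms(2) by (force simp: S_def)
  qed (use assms a b ef z in \<open>auto simp: bij_betw_def\<close>)
  with assms(3) show False by simp
qed

text \<open>Deletion with \<open>d = 14\<close> leaves codegrees of at least 15 and costs at most
  \<open>14 * n ^ 2\<close> edges; the Lagrangian bound is then applied to uniform weights.\<close>

lemma ex_K333_upper: "real (ex n K333) \<le> 2 / 25 * real n ^ 3 + 14 * real n ^ 2"
proof -
  have "real m \<le> 2 / 25 * real n ^ 3 + 14 * real n ^ 2" if m: "m \<in> ex_sizes n K333" for m
  \<comment> \<open>The weights \<open>1 / n\<close> sum to 1 only for positive
    \<open>n\<close>.\<close>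
  proof (cases "n = 0")
    case False
    obtain G :: "nat hypergraph" where G: "m = card (edges G)" "three_graph G"
      "vertices G = {..<n}" "\<not> contains_copy G K333"
      using m by (auto simp: ex_sizes_def)
    have "edges G \<subseteq> nsets {..<n} 3"
      using G(2,3) finite_subset unfolding three_graph_def nsets_def by fastforce
    then obtain H where H: "H \<subseteq> edges G" "card (edges G) \<le> card H + 14 * (card {..<n})\<^sup>2"
      "\<And>e p. e \<in> H \<Longrightarrow> p \<subseteq> e \<Longrightarrow> card p = 2 \<Longrightarrow> 14 < card {e \<in> H. p \<subseteq> e}"
      by (rule obtain_high_codegree[rotated, of _ _ 14]) auto
    have sub: "H \<subseteq> nsets {..<n} 3" using H(1) \<open>edges G \<subseteq> nsets {..<n} 3\<close> by simp
    have "hom_free H"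
      using G(2) H(1) G(4) H(3) by (rule hom_free_of_high_codegree)
    then have "weight (\<lambda>_. 1 / real n) H \<le> 2 / 25"
      using sub False by (intro lagrangian_le[of "{..<n}"]) auto
    also have "weight (\<lambda>_. 1 / real n) H = (\<Sum>e\<in>H. (1 / real n) ^ 3)"
      unfolding weight_def using sub by (intro sum.cong) (auto simp: nsets_def)
    finally have "real (card H) \<le> 2 / 25 * real n ^ 3"
      using False by (simp add: field_simps)
    moreover have "real m \<le> real (card H) + 14 * real n ^ 2"
      using H(2) unfolding G(1) by (simp flip: of_nat_power of_nat_mult of_nat_add
        add: of_nat_le_iff del: of_nat_numeral)
    ultimately show ?thesis by simp
  next
    case True
    have "edges G = {}" if "three_graph G" "vertices G = {..<n}" for G :: "nat hypergraph"
      using that True by (fastforce simp: three_graph_def)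
    then have "m = 0" using m by (auto simp: ex_sizes_def)
    then show ?thesis by simp
  qed
  moreover have "ex n K333 \<in> ex_sizes n K333"
    unfolding ex_def by (intro Max_in finite_ex_sizes ex_sizes_nonempty edges_K333_nonempty)
  ultimately show ?thesis by blast
qed

section \<open>The lower bound\<close>

text \<open>The balanced blow-up of the complete 3-graph on five vertices, with the residue classes
  modulo 5 as parts.\<close>

definition blowup_edges :: "nat \<Rightarrow> nat set set" where
  "blowup_edges n = {e \<in> nsets {..<n} 3. inj_on (\<lambda>v. v mod 5) e}"

lemma three_graph_blowup: "three_graph ({..<n}, blowup_edges n)"
  by (auto simp: three_graph_def blowup_edges_def nsets_def vertices_def edges_def)

text \<open>All pairs among the six vertices \<open>X i\<close>, \<open>Y j\<close> are covered by edges, so they would need six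
  different residues modulo \<open>5\<close>.\<close>

lemma blowup_not_contains_K333: "\<not> contains_copy ({..<n}, blowup_edges n) K333"
proof
  assume "contains_copy ({..<n}, blowup_edges n) K333"
  then obtain f where inj: "inj_on f (vertices K333)"
    and f: "\<And>e. e \<in> edges K333 \<Longrightarrow> f ` e \<in> blowup_edges n"
    unfolding contains_copy_def edges_def by auto
  define c where "c v = f v mod 5" for v
  have sub: "e \<subseteq> vertices K333" if "e \<in> edges K333" for e
    using three_graph_K333 that by (simp add: three_graph_def)
  have c: "c u \<noteq> c v" if "e \<in> edges K333" "{u, v} \<subseteq> e" "u \<noteq> v" for e u v
  proof -
    have "f u \<noteq> f v"
      using inj sub[OF that(1)] that(2,3) by (auto dest: inj_onD)
    moreover have "inj_on (\<lambda>v. v mod 5) (f ` e)"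
      using f[OF that(1)] by (simp add: blowup_edges_def)
    ultimately show ?thesis
      using that(2) unfolding c_def by (auto dest: inj_onD)
  qed
  have one_three: "{1..3::nat} = {1, 2, 3}" by auto
  then have E: "X ` {1..3} \<in> edges K333" "Y ` {1..3} \<in> edges K333"
    by (simp_all add: K333_def edges_def)
  have XY: "{X i, Y j, Z i j} \<in> edges K333" if "i \<in> {1..3}" "j \<in> {1..3}" for i j
    using that unfolding K333_def edges_def by auto
  have "inj_on c (X ` {1..3} \<union> Y ` {1..3})"
  proof (rule inj_onI, rule ccontr)
    fix u v assume uv: "u \<in> X ` {1..3} \<union> Y ` {1..3}" "v \<in> X ` {1..3} \<union> Y ` {1..3}" "u \<noteq> v"
      and eq: "c u = c v"
    have "\<exists>e\<in>edges K333. {u, v} \<subseteq> e"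
      using uv(1,2)
    proof (elim UnE imageE)
      fix i j assume "u = X i" "v = X j" "i \<in> {1..3}" "j \<in> {1..3}"
      then show ?thesis by (intro bexI[OF _ E(1)]) simp
    next
      fix i j assume "u = Y i" "v = Y j" "i \<in> {1..3}" "j \<in> {1..3}"
      then show ?thesis by (intro bexI[OF _ E(2)]) simp
    next
      fix i j assume "u = X i" "v = Y j" "i \<in> {1..3}" "j \<in> {1..3}"
      then show ?thesis by (intro bexI[OF _ XY[of i j]]) simp_all
    next
      fix i j assume "u = Y j" "v = X i" "i \<in> {1..3}" "j \<in> {1..3}"
      then show ?thesis by (intro bexI[OF _ XY[of i j]]) simp_all
    qed
    then show False using c uv(3) eq by metis
  qed
  moreover have "c ` (X ` {1..3} \<union> Y ` {1..3}) \<subseteq> {..<5}"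
    by (auto simp: c_def)
  ultimately have "card (X ` {1..3} \<union> Y ` {1..3}) \<le> card {..<5::nat}"
    by (intro card_inj_on_le) auto
  moreover have "card (X ` {1..3} \<union> Y ` {1..3}) = 6"
    unfolding one_three by (simp add: insert_commute)
  ultimately show False by simp
qed

text \<open>Among the first \<open>5 * (n div 5)\<close> vertices every class has exactly
  \<open>n div 5\<close> members. A pair \<open>(A, g)\<close> selects three of the five classes, in
  10 ways, and the member \<open>5 * g c + c\<close> of each selected class
  \<open>c\<close>.\<close>

lemma card_blowup_edges: "10 * (n div 5) ^ 3 \<le> card (blowup_edges n)"
proof -
  let ?q = "n div 5"
  let ?P = "Sigma (nsets {..<5::nat} 3) (\<lambda>A. A \<rightarrow>\<^sub>E {..<?q})"
  let ?h = "\<lambda>(A, g). (\<lambda>c. 5 * g c + c) ` A"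
  have lt5: "c < 5" if "A \<in> nsets {..<5::nat} 3" "c \<in> A" for A c
    using that by (auto simp: nsets_def)
  \<comment> \<open>The residues recover \<open>A\<close> from the triple. This serves the
    injectivity of \<open>?h\<close>, the size of the triple and the distinctness of its
    residues.\<close>
  have mods: "(\<lambda>v. v mod 5) ` (\<lambda>c. 5 * g c + c) ` A = A" if "A \<in> nsets {..<5::nat} 3" for A g
    unfolding image_image using lt5[OF that] by (auto simp: image_iff)
  have "card ?P = (\<Sum>A\<in>nsets {..<5::nat} 3. ?q ^ 3)"
    by (subst card_SigmaI)
       (auto simp: finite_imp_finite_nsets nsets_def card_PiE finite_PiE intro!: sum.cong)
  also have "\<dots> = 10 * ?q ^ 3"
  proof -
    have "(5::nat) choose 3 = 10" by (simp add: eval_nat_numeral)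
    then show ?thesis by simp
  qed
  finally have "10 * ?q ^ 3 = card ?P" by simp
  also have "\<dots> \<le> card (blowup_edges n)"
  proof (rule card_inj_on_le[of ?h])
    show "inj_on ?h ?P"
    proof (rule inj_onI, clarify)
      fix A g A' g'
      assume A: "A \<in> nsets {..<5::nat} 3" "A' \<in> nsets {..<5::nat} 3"
        and g: "g \<in> A \<rightarrow>\<^sub>E {..<?q}" "g' \<in> A' \<rightarrow>\<^sub>E {..<?q}"
        and eq: "(\<lambda>c. 5 * g c + c) ` A = (\<lambda>c. 5 * g' c + c) ` A'"
      have "A = A'" using mods[OF A(1), of g] mods[OF A(2), of g'] eq by simp
      moreover have "g c = g' c" if "c \<in> A" for c
      proof -
        obtain c' where c': "c' \<in> A'" "5 * g c + c = 5 * g' c' + c'"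
          using eq \<open>c \<in> A\<close> by (metis (no_types, lifting) image_iff)
        have "c < 5" "c' < 5" using lt5 A c'(1) that by auto
        with c'(2) have "c = c'" by presburger
        with c'(2) show ?thesis by simp
      qed
      ultimately show "A = A' \<and> g = g'"
        using g by (auto intro: PiE_ext)
    qed
    show "?h ` ?P \<subseteq> blowup_edges n"
    proof (rule image_subsetI, clarify)
      fix A g assume A: "A \<in> nsets {..<5::nat} 3" and g: "g \<in> A \<rightarrow>\<^sub>E {..<?q}"
      let ?e = "(\<lambda>c. 5 * g c + c) ` A"
      have "finite A" "card A = 3" using A by (auto simp: nsets_def)
      then have "card A \<le> card ?e"
        using mods[OF A, of g] card_image_le[of ?e "\<lambda>v. v mod 5"] by simp
      then have card: "card ?e = 3"
        using card_image_le[OF \<open>finite A\<close>, of "\<lambda>c. 5 * g c + c"] \<open>card A = 3\<close> by simp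
      have "inj_on (\<lambda>v. v mod 5) ?e"
        using \<open>finite A\<close> \<open>card A = 3\<close> card mods[OF A, of g]
        by (intro eq_card_imp_inj_on) simp_all
      moreover have "5 * g c + c < n" if "c \<in> A" for c
      proof -
        have "g c < ?q" using g that by auto
        with lt5[OF A that] show ?thesis by presburger
      qed
      ultimately show "?e \<in> blowup_edges n"
        using \<open>finite A\<close> card by (auto simp: blowup_edges_def nsets_def)
    qed
    show "finite (blowup_edges n)"
      by (simp add: blowup_edges_def finite_imp_finite_nsets)
  qed
  finally show ?thesis .
qed

lemma ex_K333_lower: "2 / 25 * real n ^ 3 - real n ^ 2 \<le> real (ex n K333)"
proof -
  let ?G = "({..<n}, blowup_edges n)"
  have "card (blowup_edges n) \<in> ex_sizes n K333"
    unfolding ex_sizes_def using three_graph_blowup blowup_not_contains_K333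
    by (intro CollectI exI[of _ ?G]) (simp add: edges_def vertices_def)
  then have "card (blowup_edges n) \<le> ex n K333"
    unfolding ex_def by (intro Max_ge finite_ex_sizes)
  with card_blowup_edges[of n] have "10 * (n div 5) ^ 3 \<le> ex n K333" by linarith
  then have ex: "10 * real (n div 5) ^ 3 \<le> real (ex n K333)"
    by (metis of_nat_le_iff of_nat_mult of_nat_numeral of_nat_power)
  show ?thesis
  \<comment> \<open>For \<open>n\<close> at most 4 the left-hand side is not positive; otherwise
    \<open>n - 4\<close> is positive and cubing is monotone.\<close>
  proof (cases "n \<le> 4")
    case True
    then have "2 / 25 * real n ^ 3 - real n ^ 2 \<le> 0"
      using mult_right_mono[of "2 / 25 * real n" 1 "real n ^ 2"]
      by (simp add: power2_eq_square power3_eq_cube)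
    then show ?thesis by (meson of_nat_0_le_iff order_trans)
  next
    case False
    have "n \<le> 5 * (n div 5) + 4" by presburger
    then have "real n \<le> 5 * real (n div 5) + 4" by linarith
    then have "((real n - 4) / 5) ^ 3 \<le> real (n div 5) ^ 3"
      using False by (intro power_mono) auto
    \<comment> \<open>The right side exceeds the left by
      \<open>n ^ 2 / 25 + 96 / 25 * n - 128 / 25\<close>, which is positive for \<open>n\<close> at
      least 5.\<close>
    moreover have "2 / 25 * real n ^ 3 - real n ^ 2 \<le> 10 * ((real n - 4) / 5) ^ 3"
    proof -
      have "10 * ((real n - 4) / 5) ^ 3 =
          2 / 25 * real n ^ 3 - 24 / 25 * real n ^ 2 + 96 / 25 * real n - 128 / 25"
        by (simp add: power2_eq_square power3_eq_cube field_simps)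
      moreover have "0 \<le> real n ^ 2" by simp
      ultimately show ?thesis using False by linarith
    qed
    ultimately show ?thesis using ex by linarith
  qed
qed

theorem theorem4p1:
  "(\<lambda>n::nat. real (ex n K333) - 2 / 25 * real n ^ 3) \<in> o(\<lambda>n. real n ^ 3)"
proof (rule landau_o.big_small_trans)
  show "(\<lambda>n::nat. real (ex n K333) - 2 / 25 * real n ^ 3) \<in> O(\<lambda>n. real n ^ 2)"
  proof (rule bigoI[of _ 14], intro always_eventually allI)
    fix n
    have "\<bar>real (ex n K333) - 2 / 25 * real n ^ 3\<bar> \<le> 14 * real n ^ 2"
      using ex_K333_upper[of n] ex_K333_lower[of n] zero_le_power2[of "real n"]
      by (intro abs_leI) linarith+
    then show "norm (real (ex n K333) - 2 / 25 * real n ^ 3) \<le> 14 * norm (real n ^ 2)" by simp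
  qed
  show "(\<lambda>n. real n ^ 2) \<in> o(\<lambda>n. real n ^ 3)"
  proof (rule smalloI_tendsto)
    \<comment> \<open>At \<open>n = 0\<close> both sides are 0, by the convention for division by
      zero.\<close>
    have "(\<lambda>n. real n ^ 2 / real n ^ 3) = (\<lambda>n. 1 / real n)"
      by (auto simp: power2_eq_square power3_eq_cube)
    then show "(\<lambda>n. real n ^ 2 / real n ^ 3) \<longlonglongrightarrow> 0"
      by (simp add: lim_1_over_n)
    show "eventually (\<lambda>n. real n ^ 3 \<noteq> 0) sequentially"
      using eventually_gt_at_top[of 0] by eventually_elim simp
  qed
qed

end
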